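(* Let $\rho>0$ and let $H$ be regularly varying at $0$ with index $-\rho$. Suppose that $g:[0,\infty)\to[0,\infty]$ is the $(\rho,H)$-local dependence measure of a pair $(A,B)$ of nonnegative random variables, let $\lambda\in[0,\infty)$, and let $X$ be an $\mathrm{IED}^\rho_H(\lambda)$-random variable independent of $(A,B)$. If $g(0^+)=g(0)$ or $\lambda>0$, then $AX+B$ is an $\mathrm{IED}^\rho_H(\phi_\rho(\lambda))$-random variable, where $$\phi_\rho(\lambda)=\inf_{y>0}\left\{g(y)+\frac{\lambda}{y^\rho}\right\}.$$
   Context: A function $H:(0,\infty)\to(0,\infty)$ is regularly varying at $0$ with index $-\rho$ if $\lim_{x\to0^+}H(tx)/H(x)=t^{-\rho}$ for all $t>0$; by convention every such $H$ is taken continuous and nonincreasing. A nonnegative random variable $X$ is an $\mathrm{IED}^\rho_H(\lambda)$-random variable (inverse exponential decay of the left tail), where $\lambda\in[0,\infty]$, if $\lim_{x\to 0^+}\frac{-\log \mathbb{P}(X<x)}{H(x)}=\lambda$. A function $g:[0,\infty)\to[0,\infty]$ is the $(\rho,H)$-local dependence measure of a pair $(A,B)$ of nonnegative random variables if for every $y\ge 0$ the following limit exists and $$g(y)=\lim_{\varepsilon\to0^+}\frac{-\log\mathbb{P}(\varepsilon Ay+B<\varepsilon)}{H(\varepsilon)}.$$ Convention: $-\log 0=\infty$. $g(0^+)$ denotes the right limit of $g$ at $0$ (it exists since such $g$ is nondecreasing). *)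

theory Defs
  imports "HOL-Probability.Probability"
begin

text \<open>\<open>H\<close> is only meaningful on \<open>(0, \<infinity>)\<close>; its values elsewhere are never constrained or used.
  Continuity and monotonicity belong to the definition by convention.\<close>

definition regularly_varying_at_0 :: "real \<Rightarrow> (real \<Rightarrow> real) \<Rightarrow> bool" where
  "regularly_varying_at_0 \<rho> H \<longleftrightarrow>
     (\<forall>x>0. H x > 0) \<and>
     continuous_on {0<..} H \<and>
     antimono_on {0<..} H \<and>
     (\<forall>t>0. ((\<lambda>x. H (t * x) / H x) \<longlongrightarrow> t powr (- \<rho>)) (at_right 0))"

text \<open>\<open>-log p\<close> for a probability \<open>p \<in> [0, 1]\<close>, with \<open>-log 0 = \<infinity>\<close>. As \<open>- ln p \<ge> 0\<close> there, the
  coercion to \<^typ>\<open>ennreal\<close> does not truncate.\<close>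

definition neg_log :: "real \<Rightarrow> ennreal" where
  "neg_log p = (if p = 0 then \<infinity> else ennreal (- ln p))"

definition nonneg_rv :: "'a measure \<Rightarrow> ('a \<Rightarrow> real) \<Rightarrow> bool" where
  "nonneg_rv M X \<longleftrightarrow> X \<in> borel_measurable M \<and> (AE \<omega> in M. 0 \<le> X \<omega>)"

text \<open>The index \<open>\<rho>\<close> of \<open>H\<close> is determined by \<open>H\<close> and does not enter the two limits below, so it is
  not a parameter. Limits are taken in \<open>[0, \<infinity>]\<close>.\<close>

definition IED :: "'a measure \<Rightarrow> (real \<Rightarrow> real) \<Rightarrow> ennreal \<Rightarrow> ('a \<Rightarrow> real) \<Rightarrow> bool" where
  "IED M H l X \<longleftrightarrow>
     nonneg_rv M X \<and>
     ((\<lambda>x. neg_log (measure M {\<omega> \<in> space M. X \<omega> < x}) / ennreal (H x)) \<longlongrightarrow> l) (at_right 0)"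

text \<open>Only the restriction of \<open>g\<close> to \<open>[0, \<infinity>)\<close> matters.\<close>

definition local_dependence_measure ::
  "'a measure \<Rightarrow> (real \<Rightarrow> real) \<Rightarrow> ('a \<Rightarrow> real) \<Rightarrow> ('a \<Rightarrow> real) \<Rightarrow> (real \<Rightarrow> ennreal) \<Rightarrow> bool" where
  "local_dependence_measure M H A B g \<longleftrightarrow>
     nonneg_rv M A \<and> nonneg_rv M B \<and>
     (\<forall>y\<ge>0. ((\<lambda>\<epsilon>. neg_log (measure M {\<omega> \<in> space M. \<epsilon> * A \<omega> * y + B \<omega> < \<epsilon>}) / ennreal (H \<epsilon>))
        \<longlongrightarrow> g y) (at_right 0))"

text \<open>The library's \<^const>\<open>prob_space.indep_var\<close> forces both variables to have the same value type; this
  is independence of the generated sigma-algebras for variables of different types.\<close>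

definition indep_rv ::
  "'a measure \<Rightarrow> 'b measure \<Rightarrow> ('a \<Rightarrow> 'b) \<Rightarrow> 'c measure \<Rightarrow> ('a \<Rightarrow> 'c) \<Rightarrow> bool" where
  "indep_rv M S U T V \<longleftrightarrow>
     U \<in> measurable M S \<and> V \<in> measurable M T \<and>
     prob_space.indep_set M (sets (vimage_algebra (space M) U S)) (sets (vimage_algebra (space M) V T))"

definition phi :: "real \<Rightarrow> (real \<Rightarrow> ennreal) \<Rightarrow> real \<Rightarrow> ennreal" where
  "phi \<rho> g l = (INF y\<in>{0<..}. g y + ennreal (l / y powr \<rho>))"

end

theory Submission
  imports Defs
begin

text \<open>
  Write \<open>F\<^sub>y(\<epsilon>)\<close> for the probability of \<open>\<epsilon>Ay + B < \<epsilon>\<close>. Since \<open>H\<close> varies regularly, \<open>X < \<epsilon>y\<close> has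
  decay rate \<open>l / y\<^sup>\<rho>\<close> on the scale \<open>H(\<epsilon>)\<close> (\<open>IED_rescaled\<close>); by independence, the joint event
  \<open>X < \<epsilon>y, \<epsilon>Ay + B < \<epsilon>\<close> then has rate \<open>g(y) + l / y\<^sup>\<rho>\<close>. For \<open>A \<ge> 0\<close> this event forces
  \<open>AX + B < \<epsilon>\<close>, so the decay rate of \<open>AX + B\<close> is at most the infimum \<open>\<phi>\<close> of these numbers
  (\<open>prob_affine_ge\<close>).

  For the opposite bound with \<open>l > 0\<close>, cut the range of \<open>X / \<epsilon>\<close> at finitely many levels
  \<open>y\<^sub>0, \<dots>, y\<^sub>n\<close>. If \<open>AX + B < \<epsilon>\<close>, then either \<open>X < \<epsilon>y\<^sub>0\<close>, or \<open>\<epsilon>Ay\<^sub>n + B < \<epsilon>\<close>, or for some \<open>i\<close> both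
  \<open>\<epsilon>Ay\<^sub>i + B < \<epsilon>\<close> and \<open>X < \<epsilon>y\<^sub>i\<^sub>+\<^sub>1\<close> (\<open>prob_affine_le\<close>). The rates of these events are
  \<open>l / y\<^sub>0\<^sup>\<rho>\<close>, \<open>g(y\<^sub>n)\<close> and \<open>g(y\<^sub>i) + l / y\<^sub>i\<^sub>+\<^sub>1\<^sup>\<rho>\<close>. With levels in geometric progression the last
  one is at least a fixed fraction, close to 1, of \<open>g(y\<^sub>i) + l / y\<^sub>i\<^sup>\<rho> \<ge> \<phi>\<close>; a small \<open>y\<^sub>0\<close> and a
  large \<open>y\<^sub>n\<close> take care of the other two. The number of events is fixed while \<open>H(\<epsilon>)\<close> tends to infinity
  (\<open>regularly_varying_at_0_at_top\<close>), so the union bound costs nothing on the exponential scale.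

  For \<open>l = 0\<close> the event \<open>X < \<epsilon>y\<^sub>0\<close> cannot be neglected in this way. There
  \<open>\<phi> = inf\<^bsub>y > 0\<^esub> g(y)\<close>, and \<open>AX + B < \<epsilon>\<close> implies \<open>B < \<epsilon>\<close>, whose rate is \<open>g(0)\<close>; right continuity of
  \<open>g\<close> at \<open>0\<close> gives \<open>\<phi> \<le> g(0)\<close>.
\<close>

section \<open>The logarithmic scale\<close>

lemma neg_log_mult:
  assumes "0 \<le> p" "p \<le> 1" "0 \<le> q" "q \<le> 1"
  shows "neg_log (p * q) = neg_log p + neg_log q"
proof (cases "p = 0 \<or> q = 0")
  case True
  then show ?thesis by (auto simp: neg_log_def)
next
  case False
  then have "p > 0" "q > 0" using assms by auto
  then show ?thesis
    using assms by (simp add: neg_log_def ln_mult flip: ennreal_plus)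
qed

lemma neg_log_antimono:
  assumes "0 \<le> p" "p \<le> q" "q \<le> 1"
  shows "neg_log q \<le> neg_log p"
  using assms by (auto simp: neg_log_def intro!: ennreal_leI)

lemma le_neg_log_divide_iff:
  assumes "0 \<le> p" "p \<le> 1" "0 < h" "0 \<le> c"
  shows "ennreal c \<le> neg_log p / ennreal h \<longleftrightarrow> p \<le> exp (- c * h)"
proof (cases "p = 0")
  case True
  then show ?thesis by (simp add: neg_log_def ennreal_top_divide)
next
  case False
  then have p: "0 < p" "0 \<le> - ln p" using assms by auto
  then have "neg_log p / ennreal h = ennreal (- ln p / h)"
    using False assms by (simp add: neg_log_def divide_ennreal del: divide_minus_left)
  moreover have "ennreal c \<le> ennreal (- ln p / h) \<longleftrightarrow> c \<le> - ln p / h"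
    using p assms by (intro ennreal_le_iff divide_nonneg_pos)
  moreover have "c \<le> - ln p / h \<longleftrightarrow> ln p \<le> - c * h"
    using assms by (subst pos_le_divide_eq) auto
  moreover have "ln p \<le> - c * h \<longleftrightarrow> p \<le> exp (- c * h)"
    using p by (metis exp_le_cancel_iff exp_ln)
  ultimately show ?thesis by metis
qed

lemma eventually_le_exp_of_rate:
  assumes lim: "((\<lambda>x. neg_log (p x) / ennreal (h x)) \<longlongrightarrow> r) F"
    and "ennreal c < r" "0 \<le> c" "\<forall>\<^sub>F x in F. 0 < h x" "\<And>x. 0 \<le> p x" "\<And>x. p x \<le> 1"
  shows "\<forall>\<^sub>F x in F. p x \<le> exp (- c * h x)"
  using order_tendstoD(1)[OF lim \<open>ennreal c < r\<close>] \<open>\<forall>\<^sub>F x in F. 0 < h x\<close>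
proof eventually_elim
  case (elim x)
  then show ?case
    using le_neg_log_divide_iff[of "p x" "h x" c] assms(3,5,6) by (simp add: less_imp_le)
qed

text \<open>Any slack in the exponential rate absorbs a constant factor, hence a union bound over a fixed
  number of events.\<close>

lemma eventually_mult_exp_le_exp:
  fixes h :: "'a \<Rightarrow> real"
  assumes "filterlim h at_top F" "c' < c" "0 < N"
  shows "\<forall>\<^sub>F x in F. N * exp (- c * h x) \<le> exp (- c' * h x)"
proof -
  have "\<forall>\<^sub>F x in F. ln N / (c - c') \<le> h x"
    using assms(1) by (simp add: filterlim_at_top)
  then show ?thesis
  proof eventually_elim
    case (elim x)
    then have "ln N \<le> (c - c') * h x" using assms by (simp add: field_simps)
    then have "exp (ln N + - c * h x) \<le> exp (- c' * h x)"
      by (simp add: algebra_simps)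
    then show ?case using \<open>0 < N\<close> by (subst (asm) exp_add) simp
  qed
qed

section \<open>Regular variation\<close>

text \<open>Halving the argument eventually multiplies \<open>H\<close> by more than a constant \<open>k > 1\<close>, because
  \<open>(1/2) powr (- \<rho>) > 1\<close>; so \<open>H\<close> is unbounded along a sequence of halvings, and monotonicity
  does the rest.\<close>

lemma regularly_varying_at_0_at_top:
  assumes "regularly_varying_at_0 \<rho> H" "\<rho> > 0"
  shows "filterlim H at_top (at_right 0)"
proof -
  have pos: "\<And>x. x > 0 \<Longrightarrow> H x > 0" and anti: "antimono_on {0<..} H"
    and lim: "((\<lambda>x. H (1/2 * x) / H x) \<longlongrightarrow> (1/2) powr (- \<rho>)) (at_right 0)"
    using assms unfolding regularly_varying_at_0_def by (fast, fast, simp del: times_divide_eq_left)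
  have "(1/2) powr (- \<rho>) = 2 powr \<rho>" by (simp add: powr_divide powr_minus field_simps)
  then have "1 < (1/2::real) powr (- \<rho>)" using assms(2) by simp
  then obtain k where k: "1 < k" "k < (1/2) powr (- \<rho>)" using dense by blast
  obtain d where d: "d > 0" and gt: "\<And>x. 0 < x \<Longrightarrow> x < d \<Longrightarrow> k < H (1/2 * x) / H x"
    using order_tendstoD(1)[OF lim k(2)] unfolding eventually_at_right_field by blast
  define z where "z n = d / 2 / 2 ^ n" for n :: nat
  have z: "0 < z n" "z n < d" for n
  proof -
    have "d / 2 / 2 ^ n \<le> d / 2 / 1" using d by (intro divide_left_mono) auto
    then show "0 < z n" "z n < d" using d by (simp_all add: z_def)
  qed
  have growth: "k ^ n * H (z 0) \<le> H (z n)" for n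
  proof (induction n)
    case (Suc n)
    have "k * H (z n) \<le> H (z (Suc n))"
      using gt[OF z[of n]] pos[OF z(1)[of n]] by (simp add: z_def field_simps)
    moreover have "k * (k ^ n * H (z 0)) \<le> k * H (z n)"
      using Suc k by (intro mult_left_mono) auto
    ultimately show ?case by simp
  qed simp
  show ?thesis
    unfolding filterlim_at_top
  proof
    fix Z :: real
    obtain n where "Z / H (z 0) < k ^ n" using real_arch_pow[OF k(1)] by blast
    then have "Z \<le> H (z n)"
      using growth[of n] pos[OF z(1)[of 0]] by (simp add: field_simps)
    then have "Z \<le> H x" if "0 < x" "x < z n" for x
      using monotone_onD[OF anti, of x "z n"] that by auto
    then show "\<forall>\<^sub>F x in at_right 0. Z \<le> H x"
      unfolding eventually_at_right_field using z(1) by blast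
  qed
qed

lemma ennreal_divide_cancel_middle:
  assumes "0 < u" "0 < v"
  shows "(a / ennreal u) * ennreal (u / v) = a / ennreal v"
proof (cases a)
  case (real r)
  then show ?thesis using assms
    by (simp add: divide_ennreal flip: ennreal_mult)
next
  case top
  then show ?thesis using assms by (simp add: ennreal_top_divide ennreal_top_mult)
qed

lemma IED_rescaled:
  assumes "IED M H (ennreal l) X" "regularly_varying_at_0 \<rho> H" "0 \<le> l" "0 < y"
  shows "((\<lambda>\<epsilon>. neg_log (measure M {\<omega> \<in> space M. X \<omega> < \<epsilon> * y}) / ennreal (H \<epsilon>))
    \<longlongrightarrow> ennreal (l / y powr \<rho>)) (at_right 0)"
proof -
  let ?f = "\<lambda>\<epsilon>. neg_log (measure M {\<omega> \<in> space M. X \<omega> < \<epsilon>})"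
  have pos: "\<And>x. x > 0 \<Longrightarrow> H x > 0"
    and ratio: "((\<lambda>x. H (y * x) / H x) \<longlongrightarrow> y powr (- \<rho>)) (at_right 0)"
    using assms unfolding regularly_varying_at_0_def by auto
  have "filterlim (\<lambda>\<epsilon>. y * \<epsilon>) (at_right 0) (at_right (0::real))"
    using filterlim_times_pos[OF filterlim_ident \<open>0 < y\<close>, of 0 0] by simp
  then have "((\<lambda>\<epsilon>. ?f (y * \<epsilon>) / ennreal (H (y * \<epsilon>))) \<longlongrightarrow> ennreal l) (at_right 0)"
    using assms(1) unfolding IED_def
    by (auto intro: filterlim_compose[where f = "(*) y" and g = "\<lambda>x. ?f x / ennreal (H x)"])
  then have lim: "((\<lambda>\<epsilon>. ?f (y * \<epsilon>) / ennreal (H (y * \<epsilon>)) * ennreal (H (y * \<epsilon>) / H \<epsilon>))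
      \<longlongrightarrow> ennreal l * ennreal (y powr (- \<rho>))) (at_right 0)"
    using \<open>0 < y\<close> by (intro tendsto_mult_ennreal tendsto_ennrealI ratio) auto
  have rate: "ennreal l * ennreal (y powr (- \<rho>)) = ennreal (l / y powr \<rho>)"
    using assms by (simp add: powr_minus field_simps flip: ennreal_mult)
  have "\<forall>\<^sub>F \<epsilon> in at_right 0.
      ?f (y * \<epsilon>) / ennreal (H (y * \<epsilon>)) * ennreal (H (y * \<epsilon>) / H \<epsilon>) = ?f (\<epsilon> * y) / ennreal (H \<epsilon>)"
    using eventually_at_right_less[of 0]
  proof eventually_elim
    case (elim \<epsilon>)
    then show ?case
      using \<open>0 < y\<close> pos[of \<epsilon>] pos[of "y * \<epsilon>"]
      by (simp add: ennreal_divide_cancel_middle mult.commute[of \<epsilon>])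
  qed
  then show ?thesis using lim unfolding rate by (rule Lim_transform_eventually[rotated])
qed

section \<open>Probability bounds for the affine image\<close>

lemma (in prob_space) prob_indep_rv:
  assumes "indep_rv M (borel \<Otimes>\<^sub>M borel) (\<lambda>\<omega>. (A \<omega>, B \<omega>)) borel X"
  shows "prob {\<omega> \<in> space M. X \<omega> < (s::real) \<and> \<epsilon> * A \<omega> * y + B \<omega> < (\<epsilon>::real)}
    = prob {\<omega> \<in> space M. X \<omega> < s} * prob {\<omega> \<in> space M. \<epsilon> * A \<omega> * y + B \<omega> < \<epsilon>}"
proof -
  let ?U = "\<lambda>\<omega>. (A \<omega>, B \<omega>)"
  have U: "?U \<in> measurable M (borel \<Otimes>\<^sub>M borel)" and X: "X \<in> borel_measurable M"
    and ind: "indep_set (sets (vimage_algebra (space M) ?U (borel \<Otimes>\<^sub>M borel)))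
      (sets (vimage_algebra (space M) X borel))"
    using assms unfolding indep_rv_def by auto
  let ?S = "{p. \<epsilon> * fst p * y + snd p < \<epsilon>} :: (real \<times> real) set"
  have "{p \<in> space (borel \<Otimes>\<^sub>M borel). \<epsilon> * fst p * y + snd p < \<epsilon>} \<in> sets (borel \<Otimes>\<^sub>M borel)"
    by measurable
  then have "?S \<in> sets (borel \<Otimes>\<^sub>M borel)" by (simp add: space_pair_measure)
  then have "?U -` ?S \<inter> space M \<in> sets (vimage_algebra (space M) ?U (borel \<Otimes>\<^sub>M borel))"
    by (rule in_vimage_algebra)
  moreover have "X -` {..<s} \<inter> space M \<in> sets (vimage_algebra (space M) X borel)"
    by (rule in_vimage_algebra) simp
  ultimately have "prob ((?U -` ?S \<inter> space M) \<inter> (X -` {..<s} \<inter> space M))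
      = prob (?U -` ?S \<inter> space M) * prob (X -` {..<s} \<inter> space M)"
    using indep_setD[OF ind] by blast
  moreover have "?U -` ?S \<inter> space M = {\<omega> \<in> space M. \<epsilon> * A \<omega> * y + B \<omega> < \<epsilon>}"
    "X -` {..<s} \<inter> space M = {\<omega> \<in> space M. X \<omega> < s}"
    by auto
  moreover have "{\<omega> \<in> space M. \<epsilon> * A \<omega> * y + B \<omega> < \<epsilon>} \<inter> {\<omega> \<in> space M. X \<omega> < s}
      = {\<omega> \<in> space M. X \<omega> < s \<and> \<epsilon> * A \<omega> * y + B \<omega> < \<epsilon>}"
    by auto
  ultimately show ?thesis by (simp add: mult.commute)
qed

lemma (in prob_space) prob_affine_ge:
  assumes "nonneg_rv M A" "nonneg_rv M B" "nonneg_rv M X"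
    and "indep_rv M (borel \<Otimes>\<^sub>M borel) (\<lambda>\<omega>. (A \<omega>, B \<omega>)) borel X"
  shows "prob {\<omega> \<in> space M. X \<omega> < \<epsilon> * y} * prob {\<omega> \<in> space M. \<epsilon> * A \<omega> * y + B \<omega> < \<epsilon>}
    \<le> prob {\<omega> \<in> space M. A \<omega> * X \<omega> + B \<omega> < \<epsilon>}"
proof -
  have [measurable]: "A \<in> borel_measurable M" "B \<in> borel_measurable M" "X \<in> borel_measurable M"
    and A: "AE \<omega> in M. 0 \<le> A \<omega>"
    using assms unfolding nonneg_rv_def by auto
  have "prob {\<omega> \<in> space M. X \<omega> < \<epsilon> * y \<and> \<epsilon> * A \<omega> * y + B \<omega> < \<epsilon>}
      \<le> prob {\<omega> \<in> space M. A \<omega> * X \<omega> + B \<omega> < \<epsilon>}"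
  proof (rule finite_measure_mono_AE)
    show "AE \<omega> in M. \<omega> \<in> {\<omega> \<in> space M. X \<omega> < \<epsilon> * y \<and> \<epsilon> * A \<omega> * y + B \<omega> < \<epsilon>}
        \<longrightarrow> \<omega> \<in> {\<omega> \<in> space M. A \<omega> * X \<omega> + B \<omega> < \<epsilon>}"
      using A
    proof eventually_elim
      case (elim \<omega>)
      then have "X \<omega> < \<epsilon> * y \<Longrightarrow> A \<omega> * X \<omega> \<le> A \<omega> * (\<epsilon> * y)"
        by (intro mult_left_mono) auto
      then show ?case by (auto simp: mult_ac)
    qed
  qed measurable
  then show ?thesis by (simp add: prob_indep_rv[OF assms(4)])
qed

lemma crossing_index:
  fixes x :: real and z :: "nat \<Rightarrow> real"
  assumes "z 0 \<le> x" "x < z n"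
  shows "\<exists>i<n. z i \<le> x \<and> x < z (Suc i)"
  using assms(2)
proof (induction n)
  case 0
  then show ?case using assms(1) by simp
next
  case (Suc n)
  then show ?case by (cases "x < z n") (auto simp: less_Suc_eq)
qed

text \<open>On \<open>\<epsilon> y\<^sub>i \<le> X < \<epsilon> y\<^sub>i\<^sub>+\<^sub>1\<close> the lower bound for \<open>X\<close> is the one that decouples \<open>A X + B\<close> from \<open>X\<close>,
  because \<open>A \<ge> 0\<close>;
  once it has turned \<open>A X + B < \<epsilon>\<close> into \<open>\<epsilon> A y\<^sub>i + B < \<epsilon>\<close>, it is dropped, and the upper bound
  carries what is left of the rarity of small \<open>X\<close>.\<close>

lemma (in prob_space) prob_affine_le:
  fixes y :: "nat \<Rightarrow> real"
  assumes "nonneg_rv M A" "nonneg_rv M B" "nonneg_rv M X"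
    and "indep_rv M (borel \<Otimes>\<^sub>M borel) (\<lambda>\<omega>. (A \<omega>, B \<omega>)) borel X"
  shows "prob {\<omega> \<in> space M. A \<omega> * X \<omega> + B \<omega> < \<epsilon>}
    \<le> prob {\<omega> \<in> space M. X \<omega> < \<epsilon> * y 0}
      + (\<Sum>i<n. prob {\<omega> \<in> space M. X \<omega> < \<epsilon> * y (Suc i)}
              * prob {\<omega> \<in> space M. \<epsilon> * A \<omega> * y i + B \<omega> < \<epsilon>})
      + prob {\<omega> \<in> space M. \<epsilon> * A \<omega> * y n + B \<omega> < \<epsilon>}" (is "?lhs \<le> _")
proof -
  have [measurable]: "A \<in> borel_measurable M" "B \<in> borel_measurable M" "X \<in> borel_measurable M"
    and A: "AE \<omega> in M. 0 \<le> A \<omega>"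
    using assms unfolding nonneg_rv_def by auto
  let ?L = "{\<omega> \<in> space M. X \<omega> < \<epsilon> * y 0}"
  let ?I = "\<lambda>i. {\<omega> \<in> space M. X \<omega> < \<epsilon> * y (Suc i) \<and> \<epsilon> * A \<omega> * y i + B \<omega> < \<epsilon>}"
  let ?R = "{\<omega> \<in> space M. \<epsilon> * A \<omega> * y n + B \<omega> < \<epsilon>}"
  have meas: "?L \<in> events" "?R \<in> events" "\<And>i. ?I i \<in> events"
    by measurable
  have "?lhs \<le> prob (?L \<union> (\<Union>i<n. ?I i) \<union> ?R)"
  proof (rule finite_measure_mono_AE)
    show "AE \<omega> in M. \<omega> \<in> {\<omega> \<in> space M. A \<omega> * X \<omega> + B \<omega> < \<epsilon>}
        \<longrightarrow> \<omega> \<in> ?L \<union> (\<Union>i<n. ?I i) \<union> ?R"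
      using A
    proof eventually_elim
      case (elim \<omega>)
      have below: "\<epsilon> * A \<omega> * v + B \<omega> < \<epsilon>" if "\<epsilon> * v \<le> X \<omega>" "A \<omega> * X \<omega> + B \<omega> < \<epsilon>" for v
        using mult_left_mono[OF that(1) elim] that(2) by (simp add: mult_ac)
      show ?case
      proof (intro impI)
        assume "\<omega> \<in> {\<omega> \<in> space M. A \<omega> * X \<omega> + B \<omega> < \<epsilon>}"
        then have \<omega>: "\<omega> \<in> space M" "A \<omega> * X \<omega> + B \<omega> < \<epsilon>" by auto
        consider "X \<omega> < \<epsilon> * y 0" | "\<epsilon> * y n \<le> X \<omega>"
          | i where "i < n" "\<epsilon> * y i \<le> X \<omega>" "X \<omega> < \<epsilon> * y (Suc i)"
          using crossing_index[of "\<lambda>i. \<epsilon> * y i" "X \<omega>" n] by force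
        then show "\<omega> \<in> ?L \<union> (\<Union>i<n. ?I i) \<union> ?R"
          using \<omega> below by cases auto
      qed
    qed
  qed (use meas in auto)
  also have "\<dots> \<le> prob (?L \<union> (\<Union>i<n. ?I i)) + prob ?R"
    using meas by (intro measure_Un_le) auto
  also have "prob (?L \<union> (\<Union>i<n. ?I i)) \<le> prob ?L + prob (\<Union>i<n. ?I i)"
    using meas by (intro measure_Un_le) auto
  also have "prob (\<Union>i<n. ?I i) \<le> (\<Sum>i<n. prob (?I i))"
    using meas by (intro finite_measure_subadditive_finite) auto
  finally show ?thesis by (simp add: prob_indep_rv[OF assms(4)])
qed

lemma (in prob_space) prob_affine_le_intercept:
  assumes "nonneg_rv M A" "nonneg_rv M B" "nonneg_rv M X"
  shows "prob {\<omega> \<in> space M. A \<omega> * X \<omega> + B \<omega> < \<epsilon>} \<le> prob {\<omega> \<in> space M. B \<omega> < \<epsilon>}"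
proof (rule finite_measure_mono_AE)
  have "AE \<omega> in M. 0 \<le> A \<omega>" "AE \<omega> in M. 0 \<le> X \<omega>"
    using assms unfolding nonneg_rv_def by auto
  then show "AE \<omega> in M. \<omega> \<in> {\<omega> \<in> space M. A \<omega> * X \<omega> + B \<omega> < \<epsilon>} \<longrightarrow> \<omega> \<in> {\<omega> \<in> space M. B \<omega> < \<epsilon>}"
  proof eventually_elim
    case (elim \<omega>)
    then have "0 \<le> A \<omega> * X \<omega>" by simp
    then show ?case by auto
  qed
next
  have [measurable]: "B \<in> borel_measurable M" using assms unfolding nonneg_rv_def by auto
  show "{\<omega> \<in> space M. B \<omega> < \<epsilon>} \<in> events" by measurable
qed

section \<open>The decay rate of the affine image\<close>

text \<open>The choice of levels. Taking \<open>y\<^sub>i\<close> with \<open>l / y\<^sub>i\<^sup>\<rho> = c' \<theta>\<^sup>i\<close>, \<open>\<theta> = c / c' < 1\<close>, makes the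
  passage from \<open>y\<^sub>i\<close> to \<open>y\<^sub>i\<^sub>+\<^sub>1\<close> cost exactly the factor \<open>\<theta>\<close>, and \<open>\<theta> \<cdot> phi > \<theta> c' = c\<close>.\<close>

lemma obtain_levels:
  fixes g :: "real \<Rightarrow> ennreal"
  assumes "0 < \<rho>" "0 < l" "0 < c" "c < c'" "ennreal c' < phi \<rho> g l"
  obtains y :: "nat \<Rightarrow> real" and n where
    "\<And>i. 0 < y i"
    "ennreal c < ennreal (l / y 0 powr \<rho>)"
    "\<And>i. ennreal c < ennreal (l / y (Suc i) powr \<rho>) + g (y i)"
    "ennreal c < g (y n)"
proof -
  define \<theta> where "\<theta> = c / c'"
  have \<theta>: "0 < \<theta>" "\<theta> < 1" "\<theta> * c' = c" using assms by (auto simp: \<theta>_def)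
  have c': "0 < c'" using assms by simp
  define y where "y i = (l / (c' * \<theta> ^ i)) powr (1 / \<rho>)" for i :: nat
  have y: "0 < y i" "l / y i powr \<rho> = c' * \<theta> ^ i" for i
    using assms \<theta> c' by (auto simp: y_def powr_powr)
  have phi_le: "ennreal c' < g (y i) + ennreal (c' * \<theta> ^ i)" for i
  proof -
    have "phi \<rho> g l \<le> g (y i) + ennreal (l / y i powr \<rho>)"
      unfolding phi_def using y(1) by (intro INF_lower) auto
    then show ?thesis using assms(5) by (simp add: y(2))
  qed
  have "(\<lambda>n. c' * \<theta> ^ n) \<longlonglongrightarrow> c' * 0"
    using \<theta> by (intro tendsto_mult tendsto_const LIMSEQ_realpow_zero) auto
  from order_tendstoD(2)[OF this, of "c' - c"]
  have "\<forall>\<^sub>F n in sequentially. c' * \<theta> ^ n < c' - c"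
    using assms by simp
  then obtain n where n: "c' * \<theta> ^ n < c' - c" by (auto simp: eventually_sequentially)
  show ?thesis
  proof
    show "0 < y i" for i by (rule y)
    show "ennreal c < ennreal (l / y 0 powr \<rho>)"
      using assms by (subst y(2)) (simp add: ennreal_less_iff)
    show "ennreal c < g (y n)"
    proof (rule ccontr)
      assume "\<not> ennreal c < g (y n)"
      then have "ennreal c' < ennreal c + ennreal (c' - c)"
        using phi_le[of n] n
        by (meson add_mono ennreal_leI less_le_trans less_imp_le not_less)
      then show False using assms by (simp flip: ennreal_plus)
    qed
    show "ennreal c < ennreal (l / y (Suc i) powr \<rho>) + g (y i)" for i
    proof (cases "g (y i)")
      case (real r)
      then have "c' < r + c' * \<theta> ^ i"
        using phi_le[of i] \<theta> c' by (simp add: ennreal_less_iff flip: ennreal_plus)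
      then have "\<theta> * c' < \<theta> * (r + c' * \<theta> ^ i)" using \<theta> by (intro mult_strict_left_mono)
      also have "\<dots> \<le> r + c' * \<theta> ^ Suc i"
        using \<theta> real mult_right_mono[of \<theta> 1 r] by (simp add: algebra_simps)
      finally show ?thesis
        using \<theta> c' real assms by (simp add: y(2) ennreal_less_iff add.commute flip: ennreal_plus)
    qed simp
  qed
qed

theorem theorem3p9:
  fixes M :: "'a measure" and A B X :: "'a \<Rightarrow> real"
    and H :: "real \<Rightarrow> real" and g :: "real \<Rightarrow> ennreal" and \<rho> l :: real
  assumes "prob_space M"
    and "\<rho> > 0"
    and "regularly_varying_at_0 \<rho> H"
    and "local_dependence_measure M H A B g"
    and "l \<ge> 0"
    and "IED M H (ennreal l) X"
    and "indep_rv M (borel \<Otimes>\<^sub>M borel) (\<lambda>\<omega>. (A \<omega>, B \<omega>)) borel X"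
    and "(g \<longlongrightarrow> g 0) (at_right 0) \<or> l > 0"
  shows "IED M H (phi \<rho> g l) (\<lambda>\<omega>. A \<omega> * X \<omega> + B \<omega>)"
proof -
  interpret prob_space M by fact
  note indep = \<open>indep_rv M (borel \<Otimes>\<^sub>M borel) (\<lambda>\<omega>. (A \<omega>, B \<omega>)) borel X\<close>
  have nn: "nonneg_rv M A" "nonneg_rv M B" "nonneg_rv M X"
    using assms unfolding local_dependence_measure_def IED_def by auto
  define F where "F y \<epsilon> = prob {\<omega> \<in> space M. \<epsilon> * A \<omega> * y + B \<omega> < \<epsilon>}" for y \<epsilon>
  define G where "G y \<epsilon> = prob {\<omega> \<in> space M. X \<omega> < \<epsilon> * y}" for y \<epsilon>
  define P where "P \<epsilon> = prob {\<omega> \<in> space M. A \<omega> * X \<omega> + B \<omega> < \<epsilon>}" for \<epsilon>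
  have P01: "0 \<le> P \<epsilon>" "P \<epsilon> \<le> 1" for \<epsilon> unfolding P_def by auto
  have FG01: "0 \<le> F y \<epsilon>" "F y \<epsilon> \<le> 1" "0 \<le> G y \<epsilon>" "G y \<epsilon> \<le> 1" for y \<epsilon>
    unfolding F_def G_def by auto
  have GF01: "0 \<le> G y \<epsilon> * F z \<epsilon>" "G y \<epsilon> * F z \<epsilon> \<le> 1" for y z \<epsilon>
    using FG01 by (auto intro: mult_le_one)
  have Hpos: "\<forall>\<^sub>F \<epsilon> in at_right 0. 0 < H \<epsilon>"
    using eventually_at_right_less[of 0] assms(3)
    by (auto simp: regularly_varying_at_0_def elim!: eventually_mono)
  have Htop: "filterlim H at_top (at_right 0)"
    using regularly_varying_at_0_at_top assms by blast
  have rateF: "((\<lambda>\<epsilon>. neg_log (F y \<epsilon>) / ennreal (H \<epsilon>)) \<longlongrightarrow> g y) (at_right 0)" if "0 \<le> y" for y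
    using assms(4) that unfolding F_def local_dependence_measure_def by blast
  have rateG: "((\<lambda>\<epsilon>. neg_log (G y \<epsilon>) / ennreal (H \<epsilon>)) \<longlongrightarrow> ennreal (l / y powr \<rho>)) (at_right 0)"
    if "0 < y" for y
    unfolding G_def using IED_rescaled assms that by blast
  have rateGF: "((\<lambda>\<epsilon>. neg_log (G y \<epsilon> * F z \<epsilon>) / ennreal (H \<epsilon>))
      \<longlongrightarrow> ennreal (l / y powr \<rho>) + g z) (at_right 0)" if "0 < y" "0 \<le> z" for y z
    using tendsto_add[OF rateG[OF that(1)] rateF[OF that(2)]]
    by (simp add: neg_log_mult FG01 add_divide_distrib_ennreal)

  have "((\<lambda>\<epsilon>. neg_log (P \<epsilon>) / ennreal (H \<epsilon>)) \<longlongrightarrow> phi \<rho> g l) (at_right 0)"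
  proof (rule order_tendstoI)
    fix a assume "phi \<rho> g l < a"
    then obtain y where y: "0 < y" "ennreal (l / y powr \<rho>) + g y < a"
      unfolding phi_def INF_less_iff by (auto simp: add.commute)
    have le: "neg_log (P \<epsilon>) / ennreal (H \<epsilon>) \<le> neg_log (G y \<epsilon> * F y \<epsilon>) / ennreal (H \<epsilon>)" for \<epsilon>
      using prob_affine_ge[OF nn indep, of \<epsilon> y] GF01 P01
      by (intro divide_right_mono_ennreal neg_log_antimono) (auto simp: P_def F_def G_def)
    have "\<forall>\<^sub>F \<epsilon> in at_right 0. neg_log (G y \<epsilon> * F y \<epsilon>) / ennreal (H \<epsilon>) < a"
      using order_tendstoD(2)[OF rateGF y(2)] y(1) by simp
    then show "\<forall>\<^sub>F \<epsilon> in at_right 0. neg_log (P \<epsilon>) / ennreal (H \<epsilon>) < a"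
      by (rule eventually_mono) (use le le_less_trans in blast)
  next
    fix a assume a: "a < phi \<rho> g l"
    show "\<forall>\<^sub>F \<epsilon> in at_right 0. a < neg_log (P \<epsilon>) / ennreal (H \<epsilon>)"
    proof (cases "l > 0")
      case False
      then have "l = 0" "(g \<longlongrightarrow> g 0) (at_right 0)" using assms by auto
      have "\<forall>\<^sub>F y in at_right 0. phi \<rho> g l \<le> g y"
        using eventually_at_right_less[of 0]
        by (rule eventually_mono)
           (auto simp: phi_def \<open>l = 0\<close> intro!: INF_lower)
      then have "phi \<rho> g l \<le> g 0"
        using \<open>(g \<longlongrightarrow> g 0) (at_right 0)\<close> by (intro tendsto_lowerbound) auto
      then have "\<forall>\<^sub>F \<epsilon> in at_right 0. a < neg_log (F 0 \<epsilon>) / ennreal (H \<epsilon>)"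
        using a by (intro order_tendstoD(1)[OF rateF]) auto
      then show ?thesis
      proof (rule eventually_mono)
        fix \<epsilon> assume "a < neg_log (F 0 \<epsilon>) / ennreal (H \<epsilon>)"
        also have "neg_log (F 0 \<epsilon>) / ennreal (H \<epsilon>) \<le> neg_log (P \<epsilon>) / ennreal (H \<epsilon>)"
          using prob_affine_le_intercept[OF nn, of \<epsilon>] FG01 P01
          by (intro divide_right_mono_ennreal neg_log_antimono) (auto simp: P_def F_def)
        finally show "a < neg_log (P \<epsilon>) / ennreal (H \<epsilon>)" .
      qed
    next
      case True
      \<comment> \<open>The gap from \<open>b2\<close> to \<open>b3\<close> pays for the spacing of the levels, the one from \<open>b1\<close> to
        \<open>b2\<close> for the union bound.\<close>
      obtain b1 b2 b3 where b: "a < b1" "b1 < b2" "b2 < b3" "b3 < phi \<rho> g l"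
        using a dense by metis
      obtain c1 where c1: "b1 = ennreal c1" "0 \<le> c1"
        using b by (cases b1) auto
      obtain c2 where c2: "b2 = ennreal c2" "0 \<le> c2"
        using b by (cases b2) auto
      obtain c3 where c3: "b3 = ennreal c3" "0 \<le> c3"
        using b by (cases b3) auto
      have c: "0 \<le> c1" "c1 < c2" "0 < c2" "c2 < c3" "ennreal c3 < phi \<rho> g l"
        using b c1 c2 c3 by (auto simp: ennreal_less_iff)
      obtain y n where y: "\<And>i. 0 < y i"
        "ennreal c2 < ennreal (l / y 0 powr \<rho>)"
        "\<And>i. ennreal c2 < ennreal (l / y (Suc i) powr \<rho>) + g (y i)"
        "ennreal c2 < g (y n)"
        using obtain_levels[OF \<open>0 < \<rho>\<close> True c(3-5)] by metis
      have "\<forall>\<^sub>F \<epsilon> in at_right 0. G (y 0) \<epsilon> \<le> exp (- c2 * H \<epsilon>)"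
        using y c Hpos FG01 by (intro eventually_le_exp_of_rate[OF rateG]) auto
      moreover have "\<forall>\<^sub>F \<epsilon> in at_right 0. F (y n) \<epsilon> \<le> exp (- c2 * H \<epsilon>)"
        using y c Hpos FG01 by (intro eventually_le_exp_of_rate[OF rateF]) (auto intro: less_imp_le)
      moreover have "\<forall>\<^sub>F \<epsilon> in at_right 0. \<forall>i<n. G (y (Suc i)) \<epsilon> * F (y i) \<epsilon> \<le> exp (- c2 * H \<epsilon>)"
      proof -
        have "\<forall>\<^sub>F \<epsilon> in at_right 0. G (y (Suc i)) \<epsilon> * F (y i) \<epsilon> \<le> exp (- c2 * H \<epsilon>)" for i
          using y c Hpos GF01 by (intro eventually_le_exp_of_rate[OF rateGF]) (auto intro: less_imp_le)
        then have "\<forall>\<^sub>F \<epsilon> in at_right 0. \<forall>i\<in>{..<n}. G (y (Suc i)) \<epsilon> * F (y i) \<epsilon> \<le> exp (- c2 * H \<epsilon>)"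
          by (intro eventually_ball_finite) auto
        then show ?thesis by (simp only: Ball_def lessThan_iff)
      qed
      moreover have "\<forall>\<^sub>F \<epsilon> in at_right 0. real (n + 2) * exp (- c2 * H \<epsilon>) \<le> exp (- c1 * H \<epsilon>)"
        using c by (intro eventually_mult_exp_le_exp Htop) auto
      ultimately show ?thesis
        using Hpos
      proof eventually_elim
        case (elim \<epsilon>)
        have "P \<epsilon> \<le> G (y 0) \<epsilon> + (\<Sum>i<n. G (y (Suc i)) \<epsilon> * F (y i) \<epsilon>) + F (y n) \<epsilon>"
          unfolding P_def F_def G_def by (rule prob_affine_le[OF nn indep])
        also have "(\<Sum>i<n. G (y (Suc i)) \<epsilon> * F (y i) \<epsilon>) \<le> (\<Sum>i<n. exp (- c2 * H \<epsilon>))"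
          using elim by (intro sum_mono) auto
        finally have "P \<epsilon> \<le> real (n + 2) * exp (- c2 * H \<epsilon>)"
          using elim by (simp add: algebra_simps)
        also have "\<dots> \<le> exp (- c1 * H \<epsilon>)" using elim by simp
        finally have "ennreal c1 \<le> neg_log (P \<epsilon>) / ennreal (H \<epsilon>)"
          using le_neg_log_divide_iff[of "P \<epsilon>" "H \<epsilon>" c1] P01 elim c by simp
        then show ?case using b c1 by simp
      qed
    qed
  qed
  moreover have "nonneg_rv M (\<lambda>\<omega>. A \<omega> * X \<omega> + B \<omega>)"
  proof -
    have "AE \<omega> in M. 0 \<le> A \<omega>" "AE \<omega> in M. 0 \<le> B \<omega>" "AE \<omega> in M. 0 \<le> X \<omega>"
      using nn unfolding nonneg_rv_def by auto
    then have "AE \<omega> in M. 0 \<le> A \<omega> * X \<omega> + B \<omega>"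
      by eventually_elim simp
    then show ?thesis using nn unfolding nonneg_rv_def by auto
  qed
  ultimately show ?thesis unfolding IED_def P_def by simp
qed

end
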